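(* Let $m\ge 0$ and let $u$ be an eigenfunction on $\Gamma_m$ with eigenvalue $\lambda_m$. Let $\lambda_{m+1}^{(1)},\lambda_{m+1}^{(2)}$ be the two numbers $$\lambda_{m+1}^{(k)}=\frac{5+\varepsilon_{m+1}\sqrt{25-4\lambda_m}}{2},\qquad \varepsilon_{m+1}=\pm1 .$$ Then $u$ can be continued to at most two eigenfunctions on $\Gamma_{m+1}$, the eigenvalue of any such continuation being $\lambda_{m+1}^{(1)}$ or $\lambda_{m+1}^{(2)}$. Furthermore, for each $\lambda_{m+1}^{(k)}\notin\{3,5\}$ the corresponding continuation $u'$ (i.e. the eigenfunction on $\Gamma_{m+1}$ with eigenvalue $\lambda^{(k)}_{m+1}$ which is a continuation of $u$) exists and is unique, and $$u(x)=\frac13\sum_{i=0}^{2}u'(x_i)\qquad\text{for every vertex } x \text{ of } \Gamma_m, \qquad(\ast\ast)$$ where $x_0,x_1,x_2$ are the three children of $x$ in $\Gamma_{m+1}$. Conversely, if $\lambda_m$ is an eigenvalue on $\Gamma_m$ and $u'$ is an eigenfunction on $\Gamma_{m+1}$ whose eigenvalue is one of $\lambda_{m+1}^{(1)},\lambda_{m+1}^{(2)}$ and is not in $\{3,5\}$, then the function $u$ on $\Gamma_m$ defined by $(\ast\ast)$ is an eigenfunction on $\Gamma_m$ with eigenvalue $\lambda_m$.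
   Context: Let $q_0=(0,0)$, $q_1=(\tfrac12,\tfrac{\sqrt3}{2})$, $q_2=(1,0)$ and $F_i(x)=\tfrac12(x-q_i)+q_i$ for $i=0,1,2$. The Sierpinski gasket $SG$ is the unique nonempty compact subset of $\mathbb{R}^2$ with $SG=\bigcup_{i=0}^2F_i(SG)$. For an integer $m\ge0$, an $m$-cell of $SG$ is a set obtained as the image of $SG$ under a composition of $m$ of the maps $F_0,F_1,F_2$; there are $3^m$ of them. Each $m$-cell is the union of exactly three $(m+1)$-cells. The cell graph $\Gamma_m$ has one vertex for each $m$-cell, and two distinct vertices are joined by an edge (written $x\sim y$) if and only if the corresponding $m$-cells share exactly one point. The children of a vertex $x$ of $\Gamma_m$ are the three vertices of $\Gamma_{m+1}$ corresponding to the three $(m+1)$-cells contained in the $m$-cell corresponding to $x$. The graph Laplacian on $\Gamma_m$ is $\Delta_{\Gamma_m}u(x)=\sum_{y\sim x}(u(y)-u(x))$, defined at every vertex $x$. An eigenfunction on $\Gamma_m$ with eigenvalue $\lambda$ is a real-valued function $u$, not identically zero, on the vertices of $\Gamma_m$ with $-\Delta_{\Gamma_m}u=\lambda u$ at every vertex. A function $g$ on $\Gamma_{m+1}$ is a continuation of a function $f$ on $\Gamma_m$ if for every vertex $x$ of $\Gamma_m$, $f(x)$ equals the average of the values of $g$ at the three children of $x$. *)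

theory Defs
  imports "HOL-Analysis.Analysis"
begin

definition q :: "nat \<Rightarrow> real^2" where
  "q i = (if i = 0 then vector [0, 0]
          else if i = 1 then vector [1/2, sqrt 3 / 2]
          else vector [1, 0])"

text \<open>Only the indices 0, 1, 2 are ever used.\<close>

definition F :: "nat \<Rightarrow> real^2 \<Rightarrow> real^2" where
  "F i x = (1/2) *\<^sub>R (x - q i) + q i"

definition SG :: "(real^2) set" where
  "SG = (THE K. K \<noteq> {} \<and> compact K \<and> K = (\<Union>i\<in>{0, 1, 2}. F i ` K))"

text \<open>For a word $w = w_1 \ldots w_m$ this is $F_{w_1} \circ \cdots \circ F_{w_m}$.\<close>

definition F_word :: "nat list \<Rightarrow> real^2 \<Rightarrow> real^2" where
  "F_word w = foldr (\<lambda>i f. F i \<circ> f) w id"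

text \<open>A vertex of the cell graph $\Gamma_m$ is identified with the $m$-cell itself, so that
  \<open>cells m\<close> is also the vertex set of $\Gamma_m$.\<close>

definition cells :: "nat \<Rightarrow> (real^2) set set" where
  "cells m = {F_word w ` SG | w. length w = m \<and> set w \<subseteq> {0, 1, 2}}"

definition cell_adj :: "(real^2) set \<Rightarrow> (real^2) set \<Rightarrow> bool" where
  "cell_adj C D \<longleftrightarrow> C \<noteq> D \<and> (\<exists>!p. p \<in> C \<inter> D)"

definition children :: "nat \<Rightarrow> (real^2) set \<Rightarrow> (real^2) set set" where
  "children m C = {D \<in> cells (Suc m). D \<subseteq> C}"

definition cell_laplacian :: "nat \<Rightarrow> ((real^2) set \<Rightarrow> real) \<Rightarrow> (real^2) set \<Rightarrow> real" where
  "cell_laplacian m u C = (\<Sum>D | D \<in> cells m \<and> cell_adj C D. u D - u C)"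

text \<open>A real function on the vertices of $\Gamma_m$ is represented by an element of
  \<open>extensional (cells m)\<close>: its values off the vertex set are fixed, so that equality of
  HOL functions is equality on the vertices. This matters for counting and uniqueness.\<close>

definition cell_eigenfunction :: "nat \<Rightarrow> real \<Rightarrow> ((real^2) set \<Rightarrow> real) \<Rightarrow> bool" where
  "cell_eigenfunction m l u \<longleftrightarrow>
     u \<in> extensional (cells m) \<and>
     (\<exists>C\<in>cells m. u C \<noteq> 0) \<and>
     (\<forall>C\<in>cells m. - cell_laplacian m u C = l * u C)"

definition cell_eigenvalue :: "nat \<Rightarrow> real \<Rightarrow> bool" where
  "cell_eigenvalue m l \<longleftrightarrow> (\<exists>u. cell_eigenfunction m l u)"

text \<open>Every $m$-cell has exactly three children, so this is the average over the children.\<close>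

definition child_average :: "nat \<Rightarrow> ((real^2) set \<Rightarrow> real) \<Rightarrow> (real^2) set \<Rightarrow> real" where
  "child_average m g C = (1/3) * (\<Sum>D\<in>children m C. g D)"

definition continuation :: "nat \<Rightarrow> ((real^2) set \<Rightarrow> real) \<Rightarrow> ((real^2) set \<Rightarrow> real) \<Rightarrow> bool" where
  "continuation m f g \<longleftrightarrow> (\<forall>C\<in>cells m. f C = child_average m g C)"

text \<open>The totalised square root is harmless: cell graphs have maximal degree at most 3, so
  every eigenvalue \<open>l\<close> is at most 6 and $25 - 4l > 0$.\<close>

definition next_eigenvalue :: "real \<Rightarrow> real \<Rightarrow> real" where
  "next_eigenvalue e l = (5 + e * sqrt (25 - 4 * l)) / 2"

end

theory Submission imports Defs begin

text \<open>
  The proof is spectral decimation. Name an $m$-cell by its word $w$. Its corner $F_w(q_i)$ is also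
  a corner $F_v(q_j)$ of at most one other $m$-cell $v$; the pair $(v,j)$ is called opposite to
  $(w,i)$, and a corner that meets no other cell, which is one of the $q_k$, is taken to be opposite
  to itself. This makes \<open>opposite\<close> an involution on the pairs (word, corner), and with it the
  Laplacian at $w$ is the sum over the three corners of $u(v) - u(w)$, with no special treatment of
  boundary cells (\<open>cell_laplacian_cell\<close>).

  Let $u'$ on $\Gamma_{m+1}$ continue $u$, and let $u'$ have eigenvalue $\lambda'$. The neighbours of
  the child $w i$ are its two siblings and the child $v j$ on the other side of the corner, so with
  $\mu = 4 - \lambda'$ the eigenvalue equation reads
  \[ \mu\, u'(w i) = 3 u(w) + u'(v j). \]
  As opposition is an involution, the same equation holds with $(w,i)$ and $(v,j)$ exchanged, and
  eliminating $u'(v j)$ gives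
  \[ (3-\lambda')(5-\lambda')\, u'(w i) = (\mu^2 - 1)\, u'(w i) = 3\mu\, u(w) + 3 u(v). \]
  Summing over $i$ turns this into $-\Delta u = \lambda'(5-\lambda')\,u$ (\<open>spectral_decimation\<close>),
  which determines $\lambda'$ up to the sign $\varepsilon$ and proves the converse part. When
  $\lambda' \notin \{3,5\}$ the displayed formula determines $u'$ from $u$ and, read as a definition,
  produces a continuation (\<open>continuation_unique\<close>, \<open>continuation_exists\<close>).

  The bound of two continuations requires that the values $3$ and $5$ give none, because the
  formula does not determine $u'$ there. For $\lambda' = 3$ it says that $u$ changes sign along
  every edge, which is impossible on a triangle. For $\lambda' = 5$ it says that $u$ does not change
  along any edge, and then $u'$ is orthogonal to the lift of $u$ to $\Gamma_{m+1}$ while its averages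
  are $u$, so $u = 0$.

  The description of adjacency by words comes from two facts about the gasket: distinct first level
  cells $F_a(SG)$ and $F_b(SG)$ meet at most in $F_a(q_b) = F_b(q_a)$, and $q_b$ lies in the cell
  of a word only if that word is $b b \ldots b$. Both are read off from barycentric coordinates.
\<close>

section \<open>The contractions and their invariant set\<close>

lemma F_eq: "F i x = (1/2) *\<^sub>R (x + q i)"
proof -
  have "q i = (1/2) *\<^sub>R q i + (1/2) *\<^sub>R q i"
    by (simp flip: scaleR_left_distrib)
  then show ?thesis unfolding F_def by (simp add: algebra_simps)
qed

lemma dist_F: "dist (F i x) (F i y) = dist x y / 2"
  by (simp add: F_eq dist_norm flip: scaleR_diff_right)

lemma F_eq_iff [simp]: "F i x = F i y \<longleftrightarrow> x = y"
  by (simp add: F_eq)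

lemma inj_F: "inj (F i)"
  by (simp add: inj_def)

lemma F_fixes_q [simp]: "F i (q i) = q i"
  by (simp add: F_def)

lemma F_q_commute: "F i (q j) = F j (q i)"
  by (simp add: F_eq add.commute)

lemma continuous_on_F: "continuous_on S (F i)"
  unfolding F_def by (intro continuous_intros)

definition invariant :: "(real^2) set \<Rightarrow> bool" where
  "invariant K \<longleftrightarrow> K \<noteq> {} \<and> compact K \<and> K = (\<Union>i\<in>{0, 1, 2}. F i ` K)"

lemma invariantD:
  assumes "invariant K"
  shows "K \<noteq> {}" "compact K" "x \<in> K \<Longrightarrow> \<exists>i\<in>{0, 1, 2}. \<exists>y\<in>K. x = F i y"
    "i \<in> {0, 1, 2} \<Longrightarrow> y \<in> K \<Longrightarrow> F i y \<in> K"
proof -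
  have K: "K \<noteq> {}" "compact K" "K = (\<Union>i\<in>{0, 1, 2}. F i ` K)"
    using assms unfolding invariant_def by simp_all
  show "K \<noteq> {}" "compact K" using K(1,2) .
  show "\<exists>i\<in>{0, 1, 2}. \<exists>y\<in>K. x = F i y" if "x \<in> K"
    using that by (subst (asm) K(3)) blast
  show "F i y \<in> K" if "i \<in> {0, 1, 2}" "y \<in> K"
    using that by (subst K(3)) blast
qed

text \<open>Let $x = F_i(y)$ be a point of $K$ at the greatest distance from $L$. Since $F_i$ maps $L$ into
  $L$ and halves distances, $x$ is at most half as far from $L$ as $y$, so the greatest distance
  is $0$.\<close>

lemma invariant_subset:
  assumes K: "invariant K" and L: "invariant L"
  shows "K \<subseteq> L"
proof -
  have "continuous_on K (\<lambda>x. infdist x L)"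
    by (intro continuous_intros)
  then obtain x where x: "x \<in> K" "\<And>y. y \<in> K \<Longrightarrow> infdist y L \<le> infdist x L"
    using continuous_attains_sup[of K "\<lambda>x. infdist x L"] invariantD(1,2)[OF K] by blast
  then obtain i y where i: "i \<in> {0, 1, 2}" and y: "y \<in> K" "x = F i y"
    using invariantD(3)[OF K] by blast
  obtain z where z: "z \<in> L" "infdist y L = dist y z"
    using infdist_attains_inf[of L y] invariantD(1,2)[OF L] compact_imp_closed by blast
  have "F i z \<in> L"
    using i z invariantD(4)[OF L] by blast
  then have "infdist x L \<le> dist (F i y) (F i z)"
    using y infdist_le by blast
  also have "\<dots> = infdist y L / 2"
    using z by (simp add: dist_F)
  also have "\<dots> \<le> infdist x L / 2"
    using x y by simp
  finally have "infdist x L \<le> 0" by simp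
  then have "infdist y L = 0" if "y \<in> K" for y
    using x(2)[OF that] infdist_nonneg[of y L] by linarith
  then show ?thesis
    using invariantD(1,2)[OF L] in_closed_iff_infdist_zero[of L] compact_imp_closed by blast
qed

text \<open>Iterate the union of the three maps on a closed ball that this union maps into itself, and
  intersect the resulting decreasing compact sets.\<close>

lemma invariant_exists: "\<exists>K. invariant K"
proof -
  define G where "G A = (\<Union>i\<in>{0, 1, 2}. F i ` A)" for A
  define B :: "(real^2) set" where "B = cball 0 (norm (q 0) + norm (q 1) + norm (q 2))"
  define A where "A n = (G ^^ n) B" for n
  have A0: "A 0 = B" and AS: "A (Suc n) = G (A n)" for n
    by (simp_all add: A_def)
  have G_mono: "G X \<subseteq> G Y" if "X \<subseteq> Y" for X Y
    using that unfolding G_def by blast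
  have "G B \<subseteq> B"
  proof -
    have "norm (F i x) \<le> r" if "norm x \<le> r" "norm (q i) \<le> r" for i x r
      using that norm_triangle_ineq[of x "q i"] by (simp add: F_eq)
    then show ?thesis unfolding G_def B_def by fastforce
  qed
  then have dec1: "A (Suc n) \<subseteq> A n" for n
    by (induction n) (simp_all only: A0 AS G_mono)
  then have dec: "A n \<subseteq> A k" if "k \<le> n" for k n
    using lift_Suc_antimono_le[of A] that by blast
  have "B \<noteq> {}"
    unfolding B_def cball_eq_empty not_less by (intro add_nonneg_nonneg norm_ge_zero)
  have comp: "compact (A n)" for n
    by (induction n) (auto simp: A0 B_def AS G_def intro!: compact_Union compact_continuous_image continuous_on_F)
  have ne: "A n \<noteq> {}" for n
    using \<open>B \<noteq> {}\<close> by (induction n) (simp_all add: A0 AS G_def)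
  define K where "K = (\<Inter>n. A n)"
  have "compact K"
    unfolding K_def using comp by (intro compact_Inter) auto
  moreover have "K \<noteq> {}"
    unfolding K_def by (rule compact_nest) (use comp ne dec in auto)
  moreover have "G K \<subseteq> K"
  proof -
    have "G K \<subseteq> A n" for n
    proof -
      have "G K \<subseteq> A (Suc n)" unfolding AS K_def by (rule G_mono) blast
      then show ?thesis using dec1 by blast
    qed
    then show ?thesis unfolding K_def by blast
  qed
  moreover have "K \<subseteq> G K"
  proof
    fix x assume x: "x \<in> K"
    \<comment> \<open>One index serves all levels: the sets decrease and there are only finitely many indices.\<close>
    have "\<exists>i\<in>{0, 1, 2}. \<forall>n. x \<in> F i ` A n"
    proof (rule ccontr)
      assume "\<not> ?thesis"
      then have "\<forall>i\<in>{0, 1, 2}. \<exists>n. x \<notin> F i ` A n" by blast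
      then obtain N where N: "\<And>i. i \<in> {0, 1, 2} \<Longrightarrow> x \<notin> F i ` A (N i)"
        by metis
      define M where "M = N 0 + N 1 + N 2"
      have "x \<notin> F i ` A M" if "i \<in> {0, 1, 2}" for i
      proof -
        have "N i \<le> M" using that by (auto simp: M_def)
        then show ?thesis using N[OF that] dec by blast
      qed
      moreover have "x \<in> G (A M)"
        using x unfolding K_def AS[symmetric] by blast
      ultimately show False unfolding G_def by blast
    qed
    then obtain i where i: "i \<in> {0, 1, 2}" "\<And>n. x \<in> F i ` A n" by blast
    then obtain y where y: "x = F i y" by blast
    with i(2) have "y \<in> A n" for n
      by (metis F_eq_iff imageE)
    then have "y \<in> K" unfolding K_def by blast
    with i y show "x \<in> G K" unfolding G_def by blast
  qed
  ultimately have "invariant K"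
    unfolding invariant_def G_def by blast
  then show ?thesis ..
qed

lemma invariant_SG: "invariant SG"
proof -
  obtain K where K: "invariant K" using invariant_exists ..
  have "SG = (THE K. invariant K)"
    unfolding SG_def invariant_def ..
  also have "\<dots> = K"
    using K invariant_subset by (intro the_equality) blast+
  finally show ?thesis using K by simp
qed

lemmas SG_nonempty = invariantD(1)[OF invariant_SG]
  and compact_SG = invariantD(2)[OF invariant_SG]
  and SG_cases = invariantD(3)[OF invariant_SG]
  and F_in_SG = invariantD(4)[OF invariant_SG]

text \<open>The point of the gasket nearest to $q_i$ is sent by $F_i$ to a point of the gasket at half the
  distance.\<close>

lemma q_in_SG:
  assumes "i \<in> {0, 1, 2}"
  shows "q i \<in> SG"
proof -
  obtain z where z: "z \<in> SG" "infdist (q i) SG = dist (q i) z"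
    using infdist_attains_inf[of SG "q i"] SG_nonempty compact_SG by (auto simp: compact_imp_closed)
  have "dist (q i) z \<le> dist (F i (q i)) (F i z)"
    using z(2) infdist_le[OF F_in_SG[OF assms z(1)], of "q i"] by simp
  then have "dist (q i) z \<le> 0"
    unfolding dist_F by simp
  with z show ?thesis by simp
qed

section \<open>Barycentric coordinates of the gasket\<close>

text \<open>The barycentric coordinates with respect to the triangle $q_0 q_1 q_2$, in terms of the
  Cartesian ones. The map $F_j$ halves them all and then adds $\frac12$ to the $j$-th.\<close>

definition bary :: "nat \<Rightarrow> real^2 \<Rightarrow> real" where
  "bary i x = (if i = 0 then 1 - x$1 - x$2 / sqrt 3
               else if i = 1 then 2 * x$2 / sqrt 3
               else x$1 - x$2 / sqrt 3)"

lemma bary_q: "i \<in> {0, 1, 2} \<Longrightarrow> j \<in> {0, 1, 2} \<Longrightarrow> bary i (q j) = (if i = j then 1 else 0)"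
  by (auto simp: bary_def q_def)

lemma bary_F:
  assumes "i \<in> {0, 1, 2}" "j \<in> {0, 1, 2}"
  shows "bary i (F j x) = bary i x / 2 + (if i = j then 1/2 else 0)"
proof -
  have "bary i (F j x) = (bary i x + bary i (q j)) / 2"
    by (auto simp: bary_def F_eq add_divide_distrib diff_divide_distrib)
  then show ?thesis using assms by (simp add: bary_q add_divide_distrib)
qed

lemma sum_bary: "bary 0 x + bary 1 x + bary 2 x = 1"
  by (simp add: bary_def)

lemma bary_inject:
  assumes "\<And>i. i \<in> {0, 1, 2} \<Longrightarrow> bary i x = bary i y"
  shows "x = y"
  using assms[of 1] assms[of 2] by (simp add: bary_def vec_eq_iff forall_2)

text \<open>The minimum of a coordinate over the gasket is attained at some $F_j(z)$, hence it is at least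
  half of a value of that coordinate on the gasket, hence at least half of itself.\<close>

lemma bary_SG_nonneg:
  assumes i: "i \<in> {0, 1, 2}" and "x \<in> SG"
  shows "bary i x \<ge> 0"
proof -
  have "continuous_on SG (\<lambda>x. x $ k)" for k
    by (intro continuous_intros)
  then have "continuous_on SG (bary i)"
    unfolding bary_def
    by (cases "i = 0"; cases "i = 1")
       (simp_all add: continuous_on_diff continuous_on_divide continuous_on_mult)
  then obtain y where y: "y \<in> SG" "\<And>z. z \<in> SG \<Longrightarrow> bary i y \<le> bary i z"
    using continuous_attains_inf[of SG] SG_nonempty compact_SG by blast
  then obtain j z where j: "j \<in> {0, 1, 2}" and z: "z \<in> SG" "y = F j z"
    using SG_cases[of y] by blast
  have "bary i z / 2 \<le> bary i y"
    using i j z by (simp add: bary_F)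
  with y(2)[OF z(1)] y(2)[OF assms(2)] show ?thesis by linarith
qed

lemma bary_SG_le_1:
  assumes "i \<in> {0, 1, 2}" and "x \<in> SG"
  shows "bary i x \<le> 1"
  using assms sum_bary[of x] bary_SG_nonneg[of 0 x] bary_SG_nonneg[of 1 x] bary_SG_nonneg[of 2 x]
  by auto

lemma q_inject: "i \<in> {0, 1, 2} \<Longrightarrow> j \<in> {0, 1, 2} \<Longrightarrow> q i = q j \<longleftrightarrow> i = j"
  using bary_q[of i i] bary_q[of i j] by auto

lemma F_eq_q:
  assumes "i \<in> {0, 1, 2}" "j \<in> {0, 1, 2}" "x \<in> SG" "F j x = q i"
  shows "j = i \<and> x = q i"
proof -
  have "bary i x / 2 + (if i = j then 1/2 else 0) = 1"
    using bary_F[of i j x] bary_q[of i i] assms by simp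
  with bary_SG_le_1[of i x] assms have "j = i" by (auto split: if_splits)
  with assms(4) show ?thesis by (metis F_fixes_q F_eq_iff)
qed

text \<open>A common point has its $i$-th and $j$-th coordinates at least $\frac12$. All coordinates are
  nonnegative with sum $1$, so these two equal $\frac12$ and the third vanishes.\<close>

lemma F_SG_Int_F_SG:
  assumes i: "i \<in> {0, 1, 2}" and j: "j \<in> {0, 1, 2}" and "i \<noteq> j"
    and x: "x \<in> F i ` SG" "x \<in> F j ` SG"
  shows "x = F i (q j)"
proof (rule bary_inject)
  fix k :: nat assume k: "k \<in> {0, 1, 2}"
  have nonneg: "bary k x \<ge> 0" if "k \<in> {0, 1, 2}" for k
    using x(1) i that by (auto intro!: bary_SG_nonneg F_in_SG)
  have half: "bary l x \<ge> 1/2" if "l \<in> {0, 1, 2}" "x \<in> F l ` SG" for l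
  proof -
    obtain y where "y \<in> SG" "x = F l y" using \<open>x \<in> F l ` SG\<close> ..
    then show ?thesis using bary_SG_nonneg[of l y] bary_F[of l l y] that(1) by simp
  qed
  have ge: "bary i x \<ge> 1/2" "bary j x \<ge> 1/2"
    using half i j x by blast+
  have "bary k x = (if k = i \<or> k = j then 1/2 else 0)"
    using ge sum_bary[of x] nonneg[of 0] nonneg[of 1] nonneg[of 2] i j k \<open>i \<noteq> j\<close> by auto
  then show "bary k x = bary k (F i (q j))"
    using i j k \<open>i \<noteq> j\<close> by (simp add: bary_F bary_q)
qed

section \<open>Words and their corners\<close>

definition words :: "nat \<Rightarrow> nat list set" where
  "words m = {w. length w = m \<and> set w \<subseteq> {0, 1, 2}}"

definition cell :: "nat list \<Rightarrow> (real^2) set" where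
  "cell w = F_word w ` SG"

lemma words_0 [simp]: "words 0 = {[]}"
  by (auto simp: words_def)

lemma Cons_in_words [simp]: "a # w \<in> words (Suc m) \<longleftrightarrow> a \<in> {0, 1, 2} \<and> w \<in> words m"
  by (auto simp: words_def)

lemma snoc_in_words [simp]: "w @ [a] \<in> words (Suc m) \<longleftrightarrow> a \<in> {0, 1, 2} \<and> w \<in> words m"
  by (auto simp: words_def)

lemma replicate_in_words: "a \<in> {0, 1, 2} \<Longrightarrow> replicate m a \<in> words m"
  by (auto simp: words_def)

lemma words_SucE:
  assumes "w \<in> words (Suc m)"
  obtains a v where "w = a # v" "a \<in> {0, 1, 2}" "v \<in> words m"
  using assms by (cases w) (auto simp: words_def)

lemma words_Suc_snocE:
  assumes "w \<in> words (Suc m)"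
  obtains a v where "w = v @ [a]" "a \<in> {0, 1, 2}" "v \<in> words m"
  using assms by (cases w rule: rev_cases) (auto simp: words_def)

lemma finite_words: "finite (words m)"
  unfolding words_def using finite_lists_length_eq[of "{0, 1, 2::nat}" m] by (simp add: conj_commute)

lemma cells_eq: "cells m = cell ` words m"
  by (auto simp: cells_def cell_def words_def)

lemma F_word_Nil [simp]: "F_word [] x = x"
  and F_word_Cons [simp]: "F_word (a # w) x = F a (F_word w x)"
  by (simp_all add: F_word_def)

lemma F_word_append [simp]: "F_word (v @ w) x = F_word v (F_word w x)"
  by (induction v) simp_all

lemma F_word_eq_iff [simp]: "F_word w x = F_word w y \<longleftrightarrow> x = y"
  by (induction w) simp_all

lemma F_word_in_SG: "w \<in> words m \<Longrightarrow> x \<in> SG \<Longrightarrow> F_word w x \<in> SG"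
  by (induction w arbitrary: m) (auto simp: words_def intro!: F_in_SG)

lemma F_word_replicate_q [simp]: "F_word (replicate k i) (q i) = q i"
  by (induction k) simp_all

lemma F_word_eq_q:
  assumes "i \<in> {0, 1, 2}" "w \<in> words m" "x \<in> SG" "F_word w x = q i"
  shows "w = replicate m i \<and> x = q i"
  using assms(2,4)
proof (induction w arbitrary: m)
  case Nil
  then show ?case by (simp add: words_def)
next
  case (Cons a w)
  then obtain k where [simp]: "m = Suc k" and a: "a \<in> {0, 1, 2}" and w: "w \<in> words k"
    by (auto simp: words_def)
  have "F a (F_word w x) = q i"
    using Cons.prems(2) by simp
  from F_eq_q[OF assms(1) a F_word_in_SG[OF w assms(3)] this] show ?case
    using Cons.IH[OF w] by simp
qed

text \<open>The first letter of a word is the outermost map. If the word is $a\, i^k$ with $a \neq i$, then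
  $F_a(q_i) = F_i(q_a)$ shows that its corner $i$ is the corner $a$ of $i\, a^k$. If it is $i\, i^k$,
  the corner is the boundary point $q_i$, and the second branch makes it opposite to itself. In the
  remaining case the other cell shares the first letter.\<close>

fun opposite :: "nat list \<Rightarrow> nat \<Rightarrow> nat list \<times> nat" where
  "opposite [] i = ([], i)"
| "opposite (a # w) i =
     (if a \<noteq> i \<and> w = replicate (length w) i then (i # replicate (length w) a, a)
      else (a # fst (opposite w i), snd (opposite w i)))"

lemma opposite_replicate [simp]: "opposite (replicate k i) i = (replicate k i, i)"
  by (induction k) auto

lemma opposite_in_words:
  assumes "w \<in> words m" "i \<in> {0, 1, 2}"
  shows "fst (opposite w i) \<in> words m" "snd (opposite w i) \<in> {0, 1, 2}"
proof -
  have "fst (opposite w i) \<in> words m \<and> snd (opposite w i) \<in> {0, 1, 2}"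
    using assms(1)
  proof (induction w arbitrary: m)
    case Nil
    then show ?case using assms(2) by simp
  next
    case (Cons a w)
    then obtain k where [simp]: "m = Suc k" and a: "a \<in> {0, 1, 2}" and w: "w \<in> words k"
      by (auto simp: words_def)
    have "length w = k" using w by (simp add: words_def)
    with Cons.IH[OF w] a assms(2) replicate_in_words[OF a, of k] show ?case
      by (simp del: insert_iff)
  qed
  then show "fst (opposite w i) \<in> words m" "snd (opposite w i) \<in> {0, 1, 2}" by auto
qed

lemma F_word_opposite: "F_word (fst (opposite w i)) (q (snd (opposite w i))) = F_word w (q i)"
proof (induction w)
  case (Cons a w)
  then show ?case
    by (cases "a \<noteq> i \<and> w = replicate (length w) i") (auto simp: F_q_commute[of a i] dest: arg_cong[of _ _ "\<lambda>w. F_word w (q i)"])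
qed simp

text \<open>The opposite of a corner that is not a boundary point of the gasket is not one either.\<close>

lemma opposite_all_equal:
  "fst (opposite w i) = replicate (length w) (snd (opposite w i)) \<Longrightarrow> w = replicate (length w) i"
proof (induction w)
  case (Cons a w)
  then show ?case
    by (cases "a \<noteq> i \<and> w = replicate (length w) i") auto
qed simp

lemma length_opposite [simp]: "length (fst (opposite w i)) = length w"
  by (induction w) auto

lemma opposite_involution: "opposite (fst (opposite w i)) (snd (opposite w i)) = (w, i)"
proof (induction w)
  case (Cons a w)
  show ?case
  proof (cases "a \<noteq> i \<and> w = replicate (length w) i")
    case True
    then show ?thesis by auto
  next
    case False
    then have "\<not> (a \<noteq> snd (opposite w i) \<and> fst (opposite w i) = replicate (length w) (snd (opposite w i)))"
      using opposite_all_equal[of w i] by (metis opposite_replicate snd_conv)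
    with False Cons.IH show ?thesis by auto
  qed
qed simp

text \<open>The corner $i$ of the child $j$ is the midpoint between two siblings.\<close>

lemma opposite_snoc_other:
  "i \<noteq> j \<Longrightarrow> opposite (w @ [j]) i = (w @ [i], j)"
proof (induction w)
  case (Cons a w)
  have "w @ [j] \<noteq> replicate (Suc (length w)) i"
    using Cons.prems by (auto simp: replicate_append_same[symmetric])
  with Cons show ?case by simp
qed auto

text \<open>The corner $i$ of the child $i$ is the corner $i$ of the parent, seen one level deeper on both
  sides.\<close>

lemma opposite_snoc_same:
  "opposite (w @ [i]) i = (fst (opposite w i) @ [snd (opposite w i)], snd (opposite w i))"
proof (induction w)
  case (Cons a w)
  have "w @ [i] = replicate (Suc (length w)) i \<longleftrightarrow> w = replicate (length w) i"
    by (simp add: replicate_append_same[symmetric])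
  with Cons show ?case by (auto simp: replicate_append_same)
qed auto

section \<open>Adjacency of cells\<close>

lemma cell_corner: "i \<in> {0, 1, 2} \<Longrightarrow> F_word w (q i) \<in> cell w"
  unfolding cell_def by (intro imageI q_in_SG)

text \<open>By induction on the length. With a common first letter $a$ everything takes place inside $F_a$.
  If the first letters are $a \neq b$, the only possible common point is $F_a(q_b)$; it lies in both
  cells only if the remaining letters are $b \ldots b$ and $a \ldots a$.\<close>

lemma cell_Int_cell:
  assumes "v \<in> words m" "w \<in> words m" "v \<noteq> w" "x \<in> cell v" "x \<in> cell w"
  shows "\<exists>i\<in>{0, 1, 2}. fst (opposite v i) = w \<and> cell v \<inter> cell w = {F_word v (q i)}"
  using assms
proof (induction m arbitrary: v w x)
  case (Suc m)
  obtain a v' where v: "v = a # v'" "a \<in> {0, 1, 2}" "v' \<in> words m"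
    using words_SucE[OF Suc.prems(1)] .
  obtain b w' where w: "w = b # w'" "b \<in> {0, 1, 2}" "w' \<in> words m"
    using words_SucE[OF Suc.prems(2)] .
  have len: "length v' = m" "length w' = m"
    using v w by (auto simp: words_def)
  have cells: "cell v = F a ` cell v'" "cell w = F b ` cell w'"
    by (auto simp: v w cell_def)
  show ?case
  proof (cases "a = b")
    case True
    then have Int: "cell v \<inter> cell w = F a ` (cell v' \<inter> cell w')"
      unfolding cells by (simp add: image_Int[OF inj_F])
    then obtain y where "y \<in> cell v'" "y \<in> cell w'"
      using Suc.prems(4,5) by blast
    moreover have ne: "v' \<noteq> w'"
      using Suc.prems(3) True v w by simp
    ultimately obtain i where i: "i \<in> {0, 1, 2}" "fst (opposite v' i) = w'"
      "cell v' \<inter> cell w' = {F_word v' (q i)}"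
      using Suc.IH v(3) w(3) by meson
    \<comment> \<open>The $i$-th corner of $v'$ is shared with $w'$, so it is not a boundary point, and the recursive
      branch of \<open>opposite\<close> applies to \<open>v\<close>.\<close>
    have "v' \<noteq> replicate (length v') i"
      using i(2) ne by (metis fst_conv opposite_replicate)
    then show ?thesis
      using i True Int v(1) w(1) by (intro bexI[of _ i]) auto
  next
    case False
    have sub: "cell v' \<subseteq> SG" "cell w' \<subseteq> SG"
      using v w F_word_in_SG by (auto simp: cell_def)
    have only: "y = F a (q b)" if "y \<in> cell v" "y \<in> cell w" for y
      using F_SG_Int_F_SG[OF v(2) w(2) False] that sub unfolding cells by blast
    have "F a (q b) \<in> cell v" "F b (q a) \<in> cell w"
      using only[OF Suc.prems(4,5)] Suc.prems(4,5) F_q_commute[of a b] by simp_all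
    then obtain y z where "y \<in> SG" "F_word v' y = q b" "z \<in> SG" "F_word w' z = q a"
      by (auto simp: v w cell_def)
    then have rep: "v' = replicate m b" "w' = replicate m a"
      using F_word_eq_q v w by meson+
    have "fst (opposite v b) = w" "F_word v (q b) = F a (q b)"
      using False by (auto simp: v w rep)
    moreover have "cell v \<inter> cell w = {F a (q b)}"
      using only Suc.prems(4,5) by blast
    ultimately show ?thesis using w(2) by metis
  qed
qed simp

lemma cell_Int_cell_unique:
  assumes "v \<in> words m" "w \<in> words m" "v \<noteq> w"
    and x: "x \<in> cell v \<inter> cell w" and y: "y \<in> cell v \<inter> cell w"
  shows "x = y"
proof -
  obtain p where "cell v \<inter> cell w = {p}"
    using cell_Int_cell[OF assms(1-3)] x by (meson IntE)
  then show ?thesis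
    using x y by (metis singletonD)
qed

lemma cell_adj_iff:
  assumes "v \<in> words m" "w \<in> words m"
  shows "cell_adj (cell v) (cell w) \<longleftrightarrow> v \<noteq> w \<and> (\<exists>i\<in>{0, 1, 2}. fst (opposite v i) = w)"
proof
  assume "cell_adj (cell v) (cell w)"
  then have "v \<noteq> w" "cell v \<inter> cell w \<noteq> {}"
    unfolding cell_adj_def by auto
  then show "v \<noteq> w \<and> (\<exists>i\<in>{0, 1, 2}. fst (opposite v i) = w)"
    using cell_Int_cell[OF assms] by blast
next
  assume "v \<noteq> w \<and> (\<exists>i\<in>{0, 1, 2}. fst (opposite v i) = w)"
  then obtain i where ne: "v \<noteq> w" and i: "i \<in> {0, 1, 2}" "fst (opposite v i) = w" by blast
  have "F_word v (q i) \<in> cell v"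
    using i by (intro cell_corner)
  moreover have "F_word v (q i) \<in> cell w"
    using cell_corner[OF opposite_in_words(2)[OF assms(1) i(1)], of w] F_word_opposite[of v i] i(2)
    by simp
  ultimately obtain p where p: "cell v \<inter> cell w = {p}"
    using cell_Int_cell[OF assms ne] by metis
  \<comment> \<open>Two adjacent cells are different sets since a cell has several corners.\<close>
  have "cell v \<noteq> {p}"
    using cell_corner[of 0 v] cell_corner[of 1 v] q_inject[of 0 1] by auto
  with p show "cell_adj (cell v) (cell w)"
    unfolding cell_adj_def by (metis Int_absorb singletonD singletonI)
qed

lemma shared_corner_unique:
  assumes "v \<in> words m" "w \<in> words m" "v \<noteq> w" "i \<in> {0, 1, 2}" "j \<in> {0, 1, 2}"
    and "F_word v (q i) \<in> cell w" "F_word v (q j) \<in> cell w"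
  shows "i = j"
proof -
  have "F_word v (q i) \<in> cell v \<inter> cell w" "F_word v (q j) \<in> cell v \<inter> cell w"
    using assms cell_corner by auto
  then have "F_word v (q i) = F_word v (q j)"
    using cell_Int_cell_unique[OF assms(1-3)] by blast
  then show ?thesis
    using q_inject[OF assms(4,5)] by simp
qed

lemma inj_on_cell: "inj_on cell (words m)"
proof (rule inj_onI, rule ccontr)
  fix v w assume "v \<in> words m" "w \<in> words m" "cell v = cell w" "v \<noteq> w"
  then show False
    using shared_corner_unique[of v m w 0 1] cell_corner[of _ v] by simp
qed

lemma corner_in_opposite_cell:
  assumes "w \<in> words m" "i \<in> {0, 1, 2}"
  shows "F_word w (q i) \<in> cell (fst (opposite w i))"
  using cell_corner[OF opposite_in_words(2)[OF assms], of "fst (opposite w i)"]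
  by (simp add: F_word_opposite)

text \<open>Every neighbour is met through exactly one corner, because two cells share at most one point; a
  corner opposite to itself contributes $0$.\<close>

lemma cell_laplacian_cell:
  assumes w: "w \<in> words m"
  shows "cell_laplacian m u (cell w) =
    (\<Sum>i\<in>{0, 1, 2}. u (cell (fst (opposite w i))) - u (cell w))"
proof -
  define I where "I = {i \<in> {0, 1, 2}. fst (opposite w i) \<noteq> w}"
  have opp: "fst (opposite w i) \<in> words m" if "i \<in> {0, 1, 2}" for i
    using opposite_in_words[OF w that] by simp
  have "{D \<in> cells m. cell_adj (cell w) D} = (\<lambda>i. cell (fst (opposite w i))) ` I"
  proof (intro equalityI subsetI)
    fix D assume "D \<in> {D \<in> cells m. cell_adj (cell w) D}"
    then obtain v where "v \<in> words m" "D = cell v" "cell_adj (cell w) (cell v)"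
      by (auto simp: cells_eq)
    moreover from this obtain i where "i \<in> {0, 1, 2}" "fst (opposite w i) = v" "w \<noteq> v"
      using cell_adj_iff[OF w, of v] by meson
    ultimately show "D \<in> (\<lambda>i. cell (fst (opposite w i))) ` I"
      by (intro image_eqI[of _ _ i]) (simp_all add: I_def)
  next
    fix D assume "D \<in> (\<lambda>i. cell (fst (opposite w i))) ` I"
    then obtain i where i: "i \<in> {0, 1, 2}" "fst (opposite w i) \<noteq> w" "D = cell (fst (opposite w i))"
      by (auto simp: I_def)
    then show "D \<in> {D \<in> cells m. cell_adj (cell w) D}"
      using cell_adj_iff[OF w opp[OF i(1)]] opp[OF i(1)] by (simp add: cells_eq) metis
  qed
  moreover have "inj_on (\<lambda>i. cell (fst (opposite w i))) I"
  proof (rule inj_onI, rule ccontr)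
    fix i j assume I: "i \<in> I" "j \<in> I" and eq: "cell (fst (opposite w i)) = cell (fst (opposite w j))"
      and "i \<noteq> j"
    then have ij: "i \<in> {0, 1, 2}" "j \<in> {0, 1, 2}" "w \<noteq> fst (opposite w i)"
      by (auto simp: I_def)
    then show False
      using shared_corner_unique[OF w opp[OF ij(1)] ij(3,1,2)] eq \<open>i \<noteq> j\<close>
        corner_in_opposite_cell[OF w ij(1)] corner_in_opposite_cell[OF w ij(2)] by simp
  qed
  ultimately have "cell_laplacian m u (cell w) = (\<Sum>i\<in>I. u (cell (fst (opposite w i))) - u (cell w))"
    by (simp add: cell_laplacian_def sum.reindex)
  also have "\<dots> = (\<Sum>i\<in>{0, 1, 2}. u (cell (fst (opposite w i))) - u (cell w))"
    by (rule sum.mono_neutral_left) (auto simp: I_def)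
  finally show ?thesis .
qed

lemma children_cell:
  assumes w: "w \<in> words m"
  shows "children m (cell w) = (\<lambda>i. cell (w @ [i])) ` {0, 1, 2}"
proof (intro equalityI subsetI)
  fix D assume "D \<in> children m (cell w)"
  then obtain x where x: "x \<in> words (Suc m)" "D = cell x" "cell x \<subseteq> cell w"
    by (auto simp: children_def cells_eq)
  obtain a v where v: "x = v @ [a]" "a \<in> {0, 1, 2}" "v \<in> words m"
    using words_Suc_snocE[OF x(1)] .
  have "v = w"
  proof (rule ccontr)
    assume "v \<noteq> w"
    have "F_word x (q 0) \<in> cell x" "F_word x (q 1) \<in> cell x"
      by (intro cell_corner; simp)+
    moreover have "cell x \<subseteq> cell v"
      using v F_in_SG by (auto simp: cell_def)
    ultimately have "F_word x (q 0) \<in> cell v \<inter> cell w" "F_word x (q 1) \<in> cell v \<inter> cell w"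
      using x(3) by auto
    then have "F_word x (q 0) = F_word x (q 1)"
      using cell_Int_cell_unique[OF v(3) w \<open>v \<noteq> w\<close>] by blast
    then show False
      using q_inject[of 0 1] by simp
  qed
  with v x show "D \<in> (\<lambda>i. cell (w @ [i])) ` {0, 1, 2}" by blast
next
  fix D assume "D \<in> (\<lambda>i. cell (w @ [i])) ` {0, 1, 2}"
  then obtain i where i: "i \<in> {0, 1, 2}" "D = cell (w @ [i])" by blast
  then have "w @ [i] \<in> words (Suc m)" using w by simp
  moreover have "D \<subseteq> cell w"
    using i F_in_SG by (auto simp: cell_def)
  ultimately show "D \<in> children m (cell w)"
    using i by (auto simp: children_def cells_eq)
qed

lemma sum_children:
  assumes w: "w \<in> words m"
  shows "(\<Sum>D\<in>children m (cell w). g D) = (\<Sum>i\<in>{0, 1, 2}. g (cell (w @ [i])))"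
proof -
  have "inj_on (\<lambda>i. cell (w @ [i])) {0, 1, 2}"
  proof (rule inj_onI)
    fix i j :: nat assume "i \<in> {0, 1, 2}" "j \<in> {0, 1, 2}" "cell (w @ [i]) = cell (w @ [j])"
    then show "i = j"
      using inj_onD[OF inj_on_cell[of "Suc m"], of "w @ [i]" "w @ [j]"] w by simp
  qed
  then show ?thesis
    unfolding children_cell[OF w] by (subst sum.reindex) (simp_all only: o_def)
qed

section \<open>The eigenvalue equation on the children of a cell\<close>

text \<open>The child that touches the child \<open>w @ [i]\<close> from the other side of the $i$-th corner of \<open>w\<close>.
  At a boundary point this is \<open>w @ [i]\<close> itself.\<close>

definition across :: "nat list \<Rightarrow> nat \<Rightarrow> (real^2) set" where
  "across w i = cell (fst (opposite w i) @ [snd (opposite w i)])"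

lemma cell_laplacian_child:
  assumes w: "w \<in> words m" and i: "i \<in> {0, 1, 2}"
  shows "cell_laplacian (Suc m) g (cell (w @ [i])) =
    3 * child_average m g (cell w) + g (across w i) - 4 * g (cell (w @ [i]))"
proof -
  have "w @ [i] \<in> words (Suc m)" using assms by simp
  from cell_laplacian_cell[OF this, of g] i show ?thesis
    unfolding child_average_def sum_children[OF w]
    by (auto simp: opposite_snoc_other opposite_snoc_same across_def)
qed

lemma eigenfunction_on_child:
  assumes "cell_eigenfunction (Suc m) l g" "continuation m u g"
    and w: "w \<in> words m" and i: "i \<in> {0, 1, 2}"
  shows "(4 - l) * g (cell (w @ [i])) = 3 * u (cell w) + g (across w i)"
proof -
  have "cell (w @ [i]) \<in> cells (Suc m)" "cell w \<in> cells m"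
    using w i by (simp_all add: cells_eq)
  then have "- cell_laplacian (Suc m) g (cell (w @ [i])) = l * g (cell (w @ [i]))"
    "u (cell w) = child_average m g (cell w)"
    using assms(1,2) by (auto simp: cell_eigenfunction_def continuation_def)
  then show ?thesis
    by (simp add: cell_laplacian_child[OF w i] algebra_simps)
qed

lemma across_opposite: "across (fst (opposite w i)) (snd (opposite w i)) = cell (w @ [i])"
  by (simp add: across_def opposite_involution)

text \<open>The equations at the two children on either side of a corner form a linear system with
  determinant $(4-l)^2 - 1 = (3-l)(5-l)$. The formula is kept free of division so that it still
  carries information at $l = 3$ and $l = 5$.\<close>

lemma eigenfunction_on_child_solved:
  assumes "cell_eigenfunction (Suc m) l g" "continuation m u g"
    and w: "w \<in> words m" and i: "i \<in> {0, 1, 2}"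
  shows "(3 - l) * (5 - l) * g (cell (w @ [i])) =
    3 * (4 - l) * u (cell w) + 3 * u (cell (fst (opposite w i)))"
proof -
  have here: "(4 - l) * g (cell (w @ [i])) = 3 * u (cell w) + g (across w i)"
    using eigenfunction_on_child[OF assms] .
  have there: "(4 - l) * g (across w i) = 3 * u (cell (fst (opposite w i))) + g (cell (w @ [i]))"
    using eigenfunction_on_child[OF assms(1,2) opposite_in_words[OF w i]]
    by (simp add: across_opposite flip: across_def)
  have "(3 - l) * (5 - l) * g (cell (w @ [i])) =
      (4 - l) * ((4 - l) * g (cell (w @ [i]))) - g (cell (w @ [i]))"
    by (simp add: algebra_simps)
  also have "\<dots> = 3 * (4 - l) * u (cell w) + ((4 - l) * g (across w i) - g (cell (w @ [i])))"
    unfolding here by (simp add: algebra_simps)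
  finally show ?thesis unfolding there by simp
qed

lemma continuation_average:
  assumes "continuation m u g" "w \<in> words m"
  shows "(\<Sum>i\<in>{0, 1, 2}. g (cell (w @ [i]))) = 3 * u (cell w)"
proof -
  have "cell w \<in> cells m" using assms by (simp add: cells_eq)
  then have "u (cell w) = child_average m g (cell w)"
    using assms(1) by (simp add: continuation_def)
  then show ?thesis
    unfolding child_average_def sum_children[OF assms(2)] by simp
qed

text \<open>Sum the solved equations over the three children. The left side becomes a multiple of $u(w)$
  because $u$ is the average, and the right side contains the Laplacian of $u$.\<close>

lemma spectral_decimation:
  assumes "cell_eigenfunction (Suc m) l g" "continuation m u g" and w: "w \<in> words m"
  shows "- cell_laplacian m u (cell w) = l * (5 - l) * u (cell w)"
proof -
  have "(3 - l) * (5 - l) * (3 * u (cell w)) =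
      (\<Sum>i\<in>{0, 1, 2}. (3 - l) * (5 - l) * g (cell (w @ [i])))"
    unfolding continuation_average[OF assms(2) w, symmetric] by (rule sum_distrib_left)
  also have "\<dots> = (\<Sum>i\<in>{0, 1, 2}. 3 * (4 - l) * u (cell w) + 3 * u (cell (fst (opposite w i))))"
    by (rule sum.cong[OF refl]) (rule eigenfunction_on_child_solved[OF assms])
  also have "\<dots> = 3 * (cell_laplacian m u (cell w) + 3 * (5 - l) * u (cell w))"
    unfolding cell_laplacian_cell[OF w] by (simp add: algebra_simps)
  finally show ?thesis
    by (simp add: algebra_simps)
qed

section \<open>The exceptional eigenvalues\<close>

text \<open>At $l = 3$ the solved equations say that the values of $u$ on the two sides of each corner are
  opposite. Three sibling cells are pairwise adjacent, so $u$ vanishes on them. On $\Gamma_0$, the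
  corners of the single cell are opposite to themselves.\<close>

lemma eigenvalue_3_continues_only_zero:
  assumes "cell_eigenfunction (Suc m) 3 g" "continuation m u g" and w: "w \<in> words m"
  shows "u (cell w) = 0"
proof -
  have opp: "u (cell (fst (opposite v i))) = - u (cell v)" if "v \<in> words m" "i \<in> {0, 1, 2}" for v i
    using eigenfunction_on_child_solved[OF assms(1,2) that] by simp
  show ?thesis
  proof (cases m)
    case 0
    then show ?thesis using opp[of "[]" 0] w by simp
  next
    case (Suc k)
    then obtain v a where v: "w = v @ [a]" "a \<in> {0, 1, 2}" "v \<in> words k"
      using w words_Suc_snocE by metis
    have "u (cell (v @ [j])) = - u (cell (v @ [i]))"
      if "i \<in> {0, 1, 2}" "j \<in> {0, 1, 2}" "i \<noteq> j" for i j
      using opp[of "v @ [i]" j] that v(3) Suc by (simp add: opposite_snoc_other)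
    from this[of 0 1] this[of 1 2] this[of 0 2]
    have "u (cell (v @ [i])) = 0" if "i \<in> {0, 1, 2}" for i
      using that by auto
    then show ?thesis using v by simp
  qed
qed

text \<open>At $l = 5$ the solved equations say that $u$ agrees across each corner, and the equations at the
  children say that $g$ sums to $-3u$ over the two sides of a corner. Therefore
  $\sum_{w,i} u(w)\,g(w i)$, evaluated by pairing opposite corners, is a negative multiple of
  $\sum_w u(w)^2$; evaluated by averaging over the children it is a positive one.\<close>

lemma eigenvalue_5_continues_only_zero:
  assumes "cell_eigenfunction (Suc m) 5 g" "continuation m u g" and w: "w \<in> words m"
  shows "u (cell w) = 0"
proof -
  define P where "P = words m \<times> {0, 1, 2::nat}"
  define U where "U = (\<lambda>(w, i::nat). u (cell w))"
  define H where "H = (\<lambda>(w, i). g (cell (w @ [i])))"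
  define s where "s = (\<lambda>(w, i). opposite w i)"
  define S where "S = (\<Sum>w\<in>words m. (u (cell w))\<^sup>2)"
  have "s ` P \<subseteq> P"
  proof (rule image_subsetI)
    fix p assume "p \<in> P"
    then show "s p \<in> P"
      using opposite_in_words[of "fst p" m "snd p"] unfolding P_def s_def
      by (simp add: mem_Times_iff case_prod_beta del: insert_iff)
  qed
  then have s_bij: "bij_betw s P P"
    by (intro bij_betw_byWitness[where f' = s])
       (simp_all add: s_def case_prod_beta opposite_involution)
  have U_s: "U (s p) = U p" if "p \<in> P" for p
    using that eigenfunction_on_child_solved[OF assms(1,2), of "fst p" "snd p"]
    by (auto simp: P_def U_def s_def case_prod_beta)
  have H_s: "H p + H (s p) = - 3 * U p" if "p \<in> P" for p
    using that eigenfunction_on_child[OF assms(1,2), of "fst p" "snd p"]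
    by (auto simp: P_def U_def H_def s_def case_prod_beta across_def)
  \<comment> \<open>First evaluation: symmetrise over opposite corners.\<close>
  have "(\<Sum>p\<in>P. U p * H p) = (\<Sum>p\<in>P. U (s p) * H (s p))"
    by (rule sum.reindex_bij_betw[OF s_bij, symmetric])
  also have "\<dots> = (\<Sum>p\<in>P. U p * H (s p))"
    by (rule sum.cong) (simp_all add: U_s)
  finally have "2 * (\<Sum>p\<in>P. U p * H p) = (\<Sum>p\<in>P. U p * (H p + H (s p)))"
    by (simp add: distrib_left sum.distrib)
  also have "\<dots> = - 3 * (\<Sum>p\<in>P. (U p)\<^sup>2)"
    unfolding sum_distrib_left by (rule sum.cong) (simp_all add: H_s power2_eq_square)
  also have "(\<Sum>p\<in>P. (U p)\<^sup>2) = 3 * (\<Sum>w\<in>words m. (u (cell w))\<^sup>2)"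
    unfolding P_def U_def sum.cartesian_product' by (simp add: sum_distrib_left)
  finally have twice: "2 * (\<Sum>p\<in>P. U p * H p) = - 9 * S"
    by (simp add: S_def)
  \<comment> \<open>Second evaluation: collect the three children of each cell.\<close>
  have "(\<Sum>p\<in>P. U p * H p) = (\<Sum>w\<in>words m. \<Sum>i\<in>{0, 1, 2}. u (cell w) * g (cell (w @ [i])))"
    unfolding P_def U_def H_def sum.cartesian_product' by simp
  also have "\<dots> = (\<Sum>w\<in>words m. u (cell w) * (3 * u (cell w)))"
    by (rule sum.cong[OF refl]) (simp only: sum_distrib_left[symmetric] continuation_average[OF assms(2)])
  also have "\<dots> = 3 * S"
    by (simp add: S_def sum_distrib_left power2_eq_square mult.left_commute)
  finally have "S = 0"
    using twice by simp
  then have "\<forall>w\<in>words m. (u (cell w))\<^sup>2 = 0"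
    unfolding S_def by (subst (asm) sum_nonneg_eq_0_iff) (auto simp: finite_words)
  with w show ?thesis by simp
qed

section \<open>Continuation of eigenfunctions\<close>

lemma nonzero_word:
  assumes "cell_eigenfunction m l u"
  obtains w where "w \<in> words m" "u (cell w) \<noteq> 0"
  using assms by (auto simp: cell_eigenfunction_def cells_eq)

lemma continuation_eigenvalue:
  assumes u: "cell_eigenfunction m l u" and g: "cell_eigenfunction (Suc m) l' g"
    and c: "continuation m u g"
  shows "l = l' * (5 - l')" "l' \<notin> {3, 5}"
proof -
  obtain w where w: "w \<in> words m" "u (cell w) \<noteq> 0"
    using nonzero_word[OF u] .
  have "- cell_laplacian m u (cell w) = l * u (cell w)"
    using u w(1) by (auto simp: cell_eigenfunction_def cells_eq)
  with spectral_decimation[OF g c w(1)] w(2) show "l = l' * (5 - l')"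
    by simp
  show "l' \<notin> {3, 5}"
    using eigenvalue_3_continues_only_zero[OF _ c w(1)] eigenvalue_5_continues_only_zero[OF _ c w(1)]
      g w(2) by blast
qed

text \<open>Evaluate the equation where $|u|$ is greatest: each of the three differences in the Laplacian is
  at most $2|u|$ there. The bound keeps $25 - 4l$ positive, so that the square root in
  \<open>next_eigenvalue\<close> has its usual meaning.\<close>

lemma cell_eigenvalue_le_6:
  assumes "cell_eigenfunction m l u"
  shows "l \<le> 6"
proof -
  define M where "M = Max ((\<lambda>v. \<bar>u (cell v)\<bar>) ` words m)"
  have fin: "finite ((\<lambda>v. \<bar>u (cell v)\<bar>) ` words m)"
    by (simp add: finite_words)
  moreover have "words m \<noteq> {}"
    using nonzero_word[OF assms] by blast
  ultimately have "M \<in> (\<lambda>v. \<bar>u (cell v)\<bar>) ` words m"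
    unfolding M_def by (intro Max_in) simp_all
  then obtain w where w: "w \<in> words m" "M = \<bar>u (cell w)\<bar>" by blast
  have max: "\<bar>u (cell v)\<bar> \<le> \<bar>u (cell w)\<bar>" if "v \<in> words m" for v
    unfolding w(2)[symmetric] M_def using fin that by (intro Max_ge) simp_all
  have pos: "\<bar>u (cell w)\<bar> > 0"
  proof -
    obtain v where "v \<in> words m" "u (cell v) \<noteq> 0"
      using nonzero_word[OF assms] .
    with max[of v] show ?thesis by linarith
  qed
  have "l * u (cell w) = - cell_laplacian m u (cell w)"
    using assms w(1) by (auto simp: cell_eigenfunction_def cells_eq)
  also have "\<dots> = (\<Sum>i\<in>{0, 1, 2}. u (cell w) - u (cell (fst (opposite w i))))"
    unfolding cell_laplacian_cell[OF w(1)] by simp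
  finally have "\<bar>l * u (cell w)\<bar> \<le> (\<Sum>i\<in>{0, 1, 2}. \<bar>u (cell w) - u (cell (fst (opposite w i)))\<bar>)"
    by (simp only: sum_abs)
  also have "\<dots> \<le> (\<Sum>i\<in>{0, 1, 2::nat}. 2 * \<bar>u (cell w)\<bar>)"
  proof (rule sum_mono)
    fix i :: nat assume "i \<in> {0, 1, 2}"
    from max[OF opposite_in_words(1)[OF w(1) this]]
    show "\<bar>u (cell w) - u (cell (fst (opposite w i)))\<bar> \<le> 2 * \<bar>u (cell w)\<bar>" by linarith
  qed
  also have "\<dots> = 6 * \<bar>u (cell w)\<bar>"
    by simp
  finally have "\<bar>l\<bar> * \<bar>u (cell w)\<bar> \<le> 6 * \<bar>u (cell w)\<bar>"
    unfolding abs_mult .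
  from mult_right_le_imp_le[OF this pos] show ?thesis by linarith
qed

lemma next_eigenvalue_iff:
  assumes "l \<le> 25 / 4"
  shows "l' \<in> {next_eigenvalue 1 l, next_eigenvalue (-1) l} \<longleftrightarrow> l = l' * (5 - l')"
proof -
  define r where "r = sqrt (25 - 4 * l)"
  have r: "r\<^sup>2 = 25 - 4 * l"
    using assms by (simp add: r_def)
  have "l' \<in> {next_eigenvalue 1 l, next_eigenvalue (-1) l} \<longleftrightarrow> 2 * l' - 5 = r \<or> 2 * l' - 5 = - r"
    unfolding next_eigenvalue_def r_def[symmetric] by (auto simp: field_simps)
  also have "\<dots> \<longleftrightarrow> (2 * l' - 5)\<^sup>2 = r\<^sup>2"
    by (simp add: power2_eq_iff)
  also have "\<dots> \<longleftrightarrow> l = l' * (5 - l')"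
    unfolding r by (auto simp: power2_eq_square algebra_simps)
  finally show ?thesis .
qed

lemma continuation_unique:
  assumes g: "cell_eigenfunction (Suc m) l g" "continuation m u g"
    and h: "cell_eigenfunction (Suc m) l h" "continuation m u h"
    and l: "l \<notin> {3, 5}"
  shows "g = h"
proof (rule extensionalityI)
  show "g \<in> extensional (cells (Suc m))" "h \<in> extensional (cells (Suc m))"
    using g h by (auto simp: cell_eigenfunction_def)
  fix D assume "D \<in> cells (Suc m)"
  then obtain w i where D: "D = cell (w @ [i])" "w \<in> words m" "i \<in> {0, 1, 2}"
    unfolding cells_eq by (metis imageE words_Suc_snocE)
  have "(3 - l) * (5 - l) * g D = (3 - l) * (5 - l) * h D"
    using eigenfunction_on_child_solved[OF g D(2,3)] eigenfunction_on_child_solved[OF h D(2,3)]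
    by (simp add: D(1))
  with l show "g D = h D" by simp
qed

text \<open>Define $g$ by the solved equations. Their sum over the children of a cell gives back $u$ because
  $u$ has eigenvalue $l'(5-l')$. Substituting the formula at both sides of a corner, which uses
  that opposition is an involution, gives the equation at each child.\<close>

lemma continuation_exists:
  assumes u: "cell_eigenfunction m l u" and l: "l = l' * (5 - l')" "l' \<notin> {3, 5}"
  shows "\<exists>g. cell_eigenfunction (Suc m) l' g \<and> continuation m u g"
proof -
  define c where "c = (3 - l') * (5 - l')"
  have c: "c \<noteq> 0" using l(2) by (simp add: c_def)
  define h where "h w i = (3 * (4 - l') * u (cell w) + 3 * u (cell (fst (opposite w i)))) / c" for w i
  define g where "g = (\<lambda>D\<in>cells (Suc m).
    let x = the_inv_into (words (Suc m)) cell D in h (butlast x) (last x))"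
  have g_child: "g (cell (w @ [i])) = h w i" if "w \<in> words m" "i \<in> {0, 1, 2}" for w i
    using that by (simp add: g_def cells_eq the_inv_into_f_f[OF inj_on_cell] del: insert_iff)
  have cont: "continuation m u g"
    unfolding continuation_def cells_eq
  proof (rule ballI, elim imageE, simp only:)
    fix w assume w: "w \<in> words m"
    have "- cell_laplacian m u (cell w) = l * u (cell w)"
      using u w by (auto simp: cell_eigenfunction_def cells_eq)
    then have "(\<Sum>i\<in>{0, 1, 2}. u (cell (fst (opposite w i)))) = (3 - l) * u (cell w)"
      unfolding cell_laplacian_cell[OF w] by (simp add: algebra_simps)
    moreover have "c * (\<Sum>i\<in>{0, 1, 2}. h w i) =
      9 * (4 - l') * u (cell w) + 3 * (\<Sum>i\<in>{0, 1, 2}. u (cell (fst (opposite w i))))"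
      using c by (simp add: h_def field_simps)
    ultimately have "c * (\<Sum>i\<in>{0, 1, 2}. h w i) = c * (3 * u (cell w))"
      by (simp add: c_def l(1) algebra_simps)
    then have "(\<Sum>i\<in>{0, 1, 2}. h w i) = 3 * u (cell w)"
      using c by simp
    moreover have "(\<Sum>i\<in>{0, 1, 2}. g (cell (w @ [i]))) = (\<Sum>i\<in>{0, 1, 2}. h w i)"
      by (rule sum.cong) (simp_all only: g_child[OF w])
    ultimately show "u (cell w) = child_average m g (cell w)"
      unfolding child_average_def sum_children[OF w] by simp
  qed
  moreover have "cell_eigenfunction (Suc m) l' g"
    unfolding cell_eigenfunction_def
  proof (intro conjI ballI)
    show "g \<in> extensional (cells (Suc m))" by (simp add: g_def)
    obtain w where w: "w \<in> words m" "u (cell w) \<noteq> 0"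
      using nonzero_word[OF u] .
    then have "(\<Sum>i\<in>{0, 1, 2}. g (cell (w @ [i]))) \<noteq> 0"
      using continuation_average[OF cont w(1)] by simp
    then obtain i where "i \<in> {0, 1, 2}" "g (cell (w @ [i])) \<noteq> 0"
      by (meson sum.neutral)
    then show "\<exists>C\<in>cells (Suc m). g C \<noteq> 0"
      using w(1) by (intro bexI[of _ "cell (w @ [i])"]) (auto simp: cells_eq)
  next
    fix D assume "D \<in> cells (Suc m)"
    then obtain w i where D: "D = cell (w @ [i])" and w: "w \<in> words m" and i: "i \<in> {0, 1, 2}"
      unfolding cells_eq by (metis imageE words_Suc_snocE)
    have "g (across w i) = h (fst (opposite w i)) (snd (opposite w i))"
      unfolding across_def by (rule g_child[OF opposite_in_words[OF w i]])
    also have "c * \<dots> = 3 * (4 - l') * u (cell (fst (opposite w i))) + 3 * u (cell w)"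
      using c by (simp add: h_def opposite_involution)
    finally have there: "c * g (across w i) = 3 * (4 - l') * u (cell (fst (opposite w i))) + 3 * u (cell w)" .
    have here: "c * g D = 3 * (4 - l') * u (cell w) + 3 * u (cell (fst (opposite w i)))"
      using c by (simp add: D g_child[OF w i] h_def)
    have "c * ((4 - l') * g D) = (4 - l') * (c * g D)" by simp
    also have "\<dots> = c * (3 * u (cell w)) + c * g (across w i)"
      unfolding here there by (simp add: c_def algebra_simps)
    also have "\<dots> = c * (3 * u (cell w) + g (across w i))"
      by (simp add: distrib_left)
    finally have "(4 - l') * g D = 3 * u (cell w) + g (across w i)"
      using c by simp
    moreover have "u (cell w) = child_average m g (cell w)"
      using cont w by (auto simp: continuation_def cells_eq)
    ultimately show "- cell_laplacian (Suc m) g D = l' * g D"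
      unfolding D cell_laplacian_child[OF w i] by (simp add: algebra_simps)
  qed
  ultimately show ?thesis by blast
qed

text \<open>Spectral decimation gives the equation. The average is not identically zero, since otherwise
  the solved equations would force $g = 0$.\<close>

lemma average_eigenfunction:
  assumes g: "cell_eigenfunction (Suc m) l g" and l: "l \<notin> {3, 5}"
  shows "cell_eigenfunction m (l * (5 - l)) (\<lambda>C\<in>cells m. child_average m g C)"
    (is "cell_eigenfunction m _ ?u")
  unfolding cell_eigenfunction_def
proof (intro conjI ballI)
  have cont: "continuation m ?u g"
    by (simp add: continuation_def)
  show "?u \<in> extensional (cells m)" by simp
  show "- cell_laplacian m ?u C = l * (5 - l) * ?u C" if "C \<in> cells m" for C
    using that spectral_decimation[OF g cont] unfolding cells_eq by blast
  show "\<exists>C\<in>cells m. ?u C \<noteq> 0"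
  proof (rule ccontr)
    assume "\<not> ?thesis"
    then have zero: "?u (cell w) = 0" if "w \<in> words m" for w
      using that unfolding cells_eq by blast
    obtain x where x: "x \<in> words (Suc m)" "g (cell x) \<noteq> 0"
      using nonzero_word[OF g] .
    then obtain w i where wi: "x = w @ [i]" "i \<in> {0, 1, 2}" "w \<in> words m"
      using words_Suc_snocE by blast
    have "(3 - l) * (5 - l) * g (cell x) = 0"
      using eigenfunction_on_child_solved[OF g cont wi(3,2)]
        zero[OF wi(3)] zero[OF opposite_in_words(1)[OF wi(3,2)]] wi(1) by simp
    with l x(2) show False by simp
  qed
qed

theorem theorem3p2:
  fixes m :: nat
  shows
    "(\<forall>l u. cell_eigenfunction m l u \<longrightarrow>
        finite {u'. (\<exists>l'. cell_eigenfunction (Suc m) l' u') \<and> continuation m u u'} \<and>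
        card {u'. (\<exists>l'. cell_eigenfunction (Suc m) l' u') \<and> continuation m u u'} \<le> 2 \<and>
        (\<forall>l' u'. cell_eigenfunction (Suc m) l' u' \<and> continuation m u u' \<longrightarrow>
           l' \<in> {next_eigenvalue 1 l, next_eigenvalue (-1) l}) \<and>
        (\<forall>l' \<in> {next_eigenvalue 1 l, next_eigenvalue (-1) l}. l' \<notin> {3, 5} \<longrightarrow>
           (\<exists>!u'. cell_eigenfunction (Suc m) l' u' \<and> continuation m u u') \<and>
           (\<forall>u'. cell_eigenfunction (Suc m) l' u' \<and> continuation m u u' \<longrightarrow>
              (\<forall>x\<in>cells m. u x = (1/3) * (\<Sum>y\<in>children m x. u' y)))))
     \<and>
     (\<forall>l l' u'. cell_eigenvalue m l \<and> cell_eigenfunction (Suc m) l' u' \<and>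
        l' \<in> {next_eigenvalue 1 l, next_eigenvalue (-1) l} \<and> l' \<notin> {3, 5} \<longrightarrow>
        cell_eigenfunction m l (\<lambda>x\<in>cells m. (1/3) * (\<Sum>y\<in>children m x. u' y)))"
proof (intro conjI allI impI)
  fix l u assume u: "cell_eigenfunction m l u"
  let ?N = "{next_eigenvalue 1 l, next_eigenvalue (-1) l}"
  let ?S = "{u'. (\<exists>l'. cell_eigenfunction (Suc m) l' u') \<and> continuation m u u'}"
  have le: "l \<le> 25 / 4"
    using cell_eigenvalue_le_6[OF u] by simp
  have ev: "l' \<in> ?N" "l' \<notin> {3, 5}"
    if "cell_eigenfunction (Suc m) l' u'" "continuation m u u'" for l' u'
    using continuation_eigenvalue[OF u that] next_eigenvalue_iff[OF le] by simp_all
  \<comment> \<open>A continuation is determined by its eigenvalue, and only two eigenvalues are possible.\<close>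
  have "?S \<subseteq> (\<lambda>l'. THE u'. cell_eigenfunction (Suc m) l' u' \<and> continuation m u u') ` ?N"
  proof
    fix u' assume "u' \<in> ?S"
    then obtain l' where l': "cell_eigenfunction (Suc m) l' u'" "continuation m u u'" by blast
    then have "(THE u'. cell_eigenfunction (Suc m) l' u' \<and> continuation m u u') = u'"
      using continuation_unique ev(2)[OF l'] by blast
    then show "u' \<in> (\<lambda>l'. THE u'. cell_eigenfunction (Suc m) l' u' \<and> continuation m u u') ` ?N"
      using ev(1)[OF l'] by (intro image_eqI[of _ _ l']) simp_all
  qed
  moreover have "card ?N \<le> 2"
    by (simp add: card_insert_if)
  ultimately show "finite ?S" "card ?S \<le> 2"
    using surj_card_le[of ?N ?S] finite_surj[of ?N ?S] by fastforce+
  show "l' \<in> ?N" if "cell_eigenfunction (Suc m) l' u' \<and> continuation m u u'" for l' u'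
    using ev that by blast
  show "\<forall>l'\<in>?N. l' \<notin> {3, 5} \<longrightarrow>
      (\<exists>!u'. cell_eigenfunction (Suc m) l' u' \<and> continuation m u u') \<and>
      (\<forall>u'. cell_eigenfunction (Suc m) l' u' \<and> continuation m u u' \<longrightarrow>
        (\<forall>x\<in>cells m. u x = (1/3) * (\<Sum>y\<in>children m x. u' y)))"
  proof (intro ballI impI conjI allI)
    fix l' assume "l' \<in> ?N" "l' \<notin> {3, 5}"
    then show "\<exists>!u'. cell_eigenfunction (Suc m) l' u' \<and> continuation m u u'"
      using continuation_exists[OF u] next_eigenvalue_iff[OF le] continuation_unique by metis
  next
    fix u' l' x assume "cell_eigenfunction (Suc m) l' u' \<and> continuation m u u'" "x \<in> cells m"
    then show "u x = (1/3) * (\<Sum>y\<in>children m x. u' y)"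
      by (simp add: continuation_def child_average_def)
  qed
next
  fix l l' u'
  assume *: "cell_eigenvalue m l \<and> cell_eigenfunction (Suc m) l' u' \<and>
    l' \<in> {next_eigenvalue 1 l, next_eigenvalue (-1) l} \<and> l' \<notin> {3, 5}"
  then obtain v where "cell_eigenfunction m l v"
    by (auto simp: cell_eigenvalue_def)
  then have "l \<le> 25 / 4"
    using cell_eigenvalue_le_6 by fastforce
  then have "l = l' * (5 - l')"
    using * next_eigenvalue_iff by blast
  then show "cell_eigenfunction m l (\<lambda>x\<in>cells m. (1/3) * (\<Sum>y\<in>children m x. u' y))"
    using average_eigenfunction[of m l' u'] * unfolding child_average_def by simp
qed

end
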